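(* Suppose $\{f_n\}$ is a sequence of extended real valued Lebesgue measurable functions on $[0,1]$, $f$ is an extended real valued function on $[0,1]$, and $g$ is a non-negative integrable function on $[0,1]$ such that $|f_n(x)|\le g(x)$ for all $n$ and almost all $x$. If $\lim_{n\to\infty}f_n(x)=f(x)$ for almost all $x$, then $f$ is integrable and $$\int f\,d\mu=\lim_{n\to\infty}\int f_n\,d\mu .$$
   Context: $\mu$ is Lebesgue measure on $[0,1]$; "for almost all $x$" means for all $x$ outside a set of Lebesgue measure zero. "Measurable function" means extended real valued Lebesgue measurable function. For a non-negative measurable function $h$, $\int h\,d\mu=\lim_{n\to\infty}\int\min\{h,n\}\,d\mu\in[0,+\infty]$, and $h$ is integrable if this is finite. For a general measurable $f$, let $f^+=\max\{f,0\}$ and $f^-=-\min\{f,0\}$; $f$ is integrable if both $f^+$ and $f^-$ are integrable, and then $\int f\,d\mu=\int f^+\,d\mu-\int f^-\,d\mu$. *)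

theory Defs
  imports "HOL-Analysis.Analysis"
begin

text \<open>Functions on \<open>[0,1]\<close> are represented as functions on all of \<open>real\<close>; only their values
  on \<open>{0..1}\<close> matter, since every notion below is taken relative to the following measure space.\<close>

abbreviation unit_lebesgue :: "real measure" where
  "unit_lebesgue \<equiv> lebesgue_on {0..1}"

text \<open>For a non-negative measurable \<open>h\<close> the truncation \<open>min {h, n}\<close> has values in \<open>[0, n]\<close>, so
  \<open>real_of_ereal\<close> loses no information and the inner integral is the library's integral of a
  bounded measurable real function. The sequence is then increasing, so \<open>lim\<close> is a genuine limit
  in \<open>ereal\<close>. The value is meaningful only for such \<open>h\<close>.\<close>

definition nonneg_integral :: "(real \<Rightarrow> ereal) \<Rightarrow> ereal" where
  "nonneg_integral h =
     lim (\<lambda>n::nat. ereal (LINT x|unit_lebesgue. real_of_ereal (min (h x) (ereal (real n)))))"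

definition pos_part :: "(real \<Rightarrow> ereal) \<Rightarrow> real \<Rightarrow> ereal" where
  "pos_part f x = max (f x) 0"

definition neg_part :: "(real \<Rightarrow> ereal) \<Rightarrow> real \<Rightarrow> ereal" where
  "neg_part f x = - min (f x) 0"

text \<open>For non-negative \<open>f\<close> we have \<open>pos_part f = f\<close> and \<open>neg_part f = 0\<close>, so the following says
  that \<open>f\<close> is measurable with \<open>nonneg_integral f < \<infinity>\<close>.\<close>

definition ext_integrable :: "(real \<Rightarrow> ereal) \<Rightarrow> bool" where
  "ext_integrable f \<longleftrightarrow>
     f \<in> borel_measurable unit_lebesgue \<and>
     nonneg_integral (pos_part f) < \<infinity> \<and> nonneg_integral (neg_part f) < \<infinity>"

definition ext_integral :: "(real \<Rightarrow> ereal) \<Rightarrow> ereal" where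
  "ext_integral f = nonneg_integral (pos_part f) - nonneg_integral (neg_part f)"

end

theory Submission imports Defs
begin

text \<open>
  The statement is reduced to dominated convergence for \<open>ennreal\<close>-valued functions. The bridge is
  \<open>nonneg_integral_eq_nn_integral\<close>: by monotone convergence the limit of the integrals of the
  truncations is \<open>nn_integral\<close>. Since \<open>e2ennreal\<close> sends negative values to
  \<open>0\<close>, the positive and negative parts of \<open>f\<close> correspond to \<open>e2ennreal (f x)\<close> and
  \<open>e2ennreal (- f x)\<close>.

  Both \<open>e2ennreal (f n x)\<close> and \<open>e2ennreal (- f n x)\<close> are dominated by \<open>e2ennreal (g x)\<close> and, because
  \<open>e2ennreal\<close> is continuous, converge almost everywhere. So the integrals of the two parts converge
  separately, and the limits are finite as they are at most the integral of \<open>g\<close>. Being finite, the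
  limits may be subtracted. The limit function is only assumed to be an almost everywhere limit; its
  measurability comes from completeness of Lebesgue measure
  (\<open>borel_measurable_AE_eq\<close>).
\<close>

lemma complete_measure_lebesgue_on:
  assumes "S \<in> sets lebesgue"
  shows "complete_measure (lebesgue_on S)"
proof
  fix A B :: "'a set"
  assume "B \<subseteq> A" "A \<in> null_sets (lebesgue_on S)"
  then have "B \<subseteq> S" "B \<in> sets lebesgue"
    using assms by (auto simp: null_sets_restrict_space null_sets_completion_subset null_setsD2)
  then show "B \<in> sets (lebesgue_on S)"
    using assms by (simp add: sets_restrict_space_iff)
qed

text \<open>The preimages of a set under two functions that agree almost everywhere differ by a subset of
  a null set, which is measurable in a complete measure space.\<close>

lemma (in complete_measure) borel_measurable_AE_eq:
  assumes "f \<in> borel_measurable M" "AE x in M. f x = g x"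
  shows "g \<in> borel_measurable M"
proof (rule measurableI)
  fix A :: "'b set"
  assume "A \<in> sets borel"
  then have "f -` A \<inter> space M \<in> sets M"
    using assms(1) by (rule measurable_sets[rotated])
  moreover have "AE x in M. x \<in> f -` A \<inter> space M \<longleftrightarrow> x \<in> g -` A \<inter> space M"
    using assms(2) by eventually_elim simp
  ultimately show "g -` A \<inter> space M \<in> sets M"
    by (rule in_sets_AE[OF _ _ Int_lower2, rotated])
qed simp

lemma (in complete_measure) borel_measurable_AE_LIMSEQ:
  fixes f :: "nat \<Rightarrow> 'a \<Rightarrow> ereal"
  assumes "\<And>n. f n \<in> borel_measurable M"
    and "AE x in M. (\<lambda>n. f n x) \<longlonglongrightarrow> F x"
  shows "F \<in> borel_measurable M"
proof (rule borel_measurable_AE_eq)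
  show "(\<lambda>x. liminf (\<lambda>n. f n x)) \<in> borel_measurable M"
    using assms(1) by measurable
  show "AE x in M. liminf (\<lambda>n. f n x) = F x"
    using assms(2) by eventually_elim (simp add: lim_imp_Liminf)
qed

lemma ennreal_truncation:
  fixes a :: ereal
  assumes "0 \<le> a"
  shows "ennreal (real_of_ereal (min a (ereal (real n)))) = e2ennreal (min a (ereal (real n)))"
  using assms by (cases a) (auto simp: min_def)

lemma truncation_LIMSEQ:
  fixes a :: ereal
  shows "(\<lambda>n. min a (ereal (real n))) \<longlonglongrightarrow> a"
proof -
  have "(\<lambda>n. min a (ereal (real n))) \<longlonglongrightarrow> min a \<infinity>"
    by (rule tendsto_min[OF tendsto_const id_nat_ereal_tendsto_PInf])
  then show ?thesis by simp
qed

lemma nonneg_integral_eq_nn_integral: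
  assumes [measurable]: "h \<in> borel_measurable unit_lebesgue" and nonneg: "\<And>x. 0 \<le> h x"
  shows "nonneg_integral h = enn2ereal (\<integral>\<^sup>+x. e2ennreal (h x) \<partial>unit_lebesgue)"
proof -
  interpret finite_measure unit_lebesgue
    by (rule finite_measureI) (simp add: space_restrict_space emeasure_restrict_space)
  define t where "t n x = min (h x) (ereal (real n))" for n :: nat and x
  have t_meas [measurable]: "t n \<in> borel_measurable unit_lebesgue" for n
    unfolding t_def by measurable
  have t_bounds: "0 \<le> real_of_ereal (t n x)" "real_of_ereal (t n x) \<le> real n" for n x
    using nonneg[of x] by (cases "h x"; auto simp: t_def min_def)+
  have t_ennreal: "ennreal (real_of_ereal (t n x)) = e2ennreal (t n x)" for n x
    unfolding t_def by (rule ennreal_truncation[OF nonneg])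
  have "integrable unit_lebesgue (\<lambda>x. real_of_ereal (t n x))" for n
    by (rule integrable_const_bound[where B = "real n"])
      (simp_all only: real_norm_def abs_of_nonneg t_bounds AE_I2, measurable)
  then have "(\<integral>\<^sup>+x. e2ennreal (t n x) \<partial>unit_lebesgue)
      = ennreal (LINT x|unit_lebesgue. real_of_ereal (t n x))" for n
    using nn_integral_eq_integral[of unit_lebesgue "\<lambda>x. real_of_ereal (t n x)",
        OF _ AE_I2[OF t_bounds(1)]]
    by (simp only: t_ennreal)
  then have trunc_eq: "ereal (LINT x|unit_lebesgue. real_of_ereal (t n x))
      = enn2ereal (\<integral>\<^sup>+x. e2ennreal (t n x) \<partial>unit_lebesgue)" for n
    by (simp add: enn2ereal_ennreal t_bounds)
  have "(\<lambda>n. \<integral>\<^sup>+x. e2ennreal (t n x) \<partial>unit_lebesgue)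
      \<longlonglongrightarrow> (\<integral>\<^sup>+x. e2ennreal (h x) \<partial>unit_lebesgue)"
  proof (rule nn_integral_LIMSEQ)
    show "incseq (\<lambda>n x. e2ennreal (t n x))"
      by (auto simp: incseq_def le_fun_def t_def intro!: e2ennreal_mono min.mono)
    show "(\<lambda>n. e2ennreal (t n x)) \<longlonglongrightarrow> e2ennreal (h x)" for x
      unfolding t_def by (intro tendsto_e2ennrealI truncation_LIMSEQ)
  qed measurable
  then have "(\<lambda>n. ereal (LINT x|unit_lebesgue. real_of_ereal (t n x)))
      \<longlonglongrightarrow> enn2ereal (\<integral>\<^sup>+x. e2ennreal (h x) \<partial>unit_lebesgue)"
    unfolding trunc_eq by (rule tendsto_enn2erealI)
  then show ?thesis
    unfolding nonneg_integral_def t_def by (rule limI)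
qed

lemma e2ennreal_pos_part: "e2ennreal (pos_part f x) = e2ennreal (f x)"
  by (auto simp: pos_part_def max_def e2ennreal_neg)

lemma e2ennreal_neg_part: "e2ennreal (neg_part f x) = e2ennreal (- f x)"
  by (auto simp: neg_part_def min_def e2ennreal_neg)

lemma nonneg_integral_pos_part:
  assumes [measurable]: "f \<in> borel_measurable unit_lebesgue"
  shows "nonneg_integral (pos_part f) = enn2ereal (\<integral>\<^sup>+x. e2ennreal (f x) \<partial>unit_lebesgue)"
proof -
  have "pos_part f \<in> borel_measurable unit_lebesgue"
    unfolding pos_part_def[abs_def] by measurable
  then show ?thesis
    by (subst nonneg_integral_eq_nn_integral) (auto simp: e2ennreal_pos_part, simp add: pos_part_def)
qed

lemma nonneg_integral_neg_part:
  assumes [measurable]: "f \<in> borel_measurable unit_lebesgue"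
  shows "nonneg_integral (neg_part f) = enn2ereal (\<integral>\<^sup>+x. e2ennreal (- f x) \<partial>unit_lebesgue)"
proof -
  have "neg_part f \<in> borel_measurable unit_lebesgue"
    unfolding neg_part_def[abs_def] by measurable
  then show ?thesis
    by (subst nonneg_integral_eq_nn_integral)
      (auto simp: e2ennreal_neg_part, simp add: neg_part_def ereal_0_le_uminus_iff)
qed

text \<open>Applied to \<open>f\<close> and to \<open>- f\<close>, this gives the convergence of the positive and the negative
  parts of the integrands; finiteness of the two limits is the integrability of \<open>F\<close>.\<close>

lemma nn_integral_e2ennreal_dominated:
  fixes f :: "nat \<Rightarrow> 'a \<Rightarrow> ereal"
  assumes [measurable]: "\<And>n. f n \<in> borel_measurable M" "F \<in> borel_measurable M"
      "g \<in> borel_measurable M"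
    and bound: "\<And>n. AE x in M. f n x \<le> g x"
    and finite: "(\<integral>\<^sup>+x. e2ennreal (g x) \<partial>M) < \<infinity>"
    and lim: "AE x in M. (\<lambda>n. f n x) \<longlonglongrightarrow> F x"
  shows "(\<lambda>n. \<integral>\<^sup>+x. e2ennreal (f n x) \<partial>M) \<longlonglongrightarrow> (\<integral>\<^sup>+x. e2ennreal (F x) \<partial>M)"
    and "(\<integral>\<^sup>+x. e2ennreal (F x) \<partial>M) < \<infinity>"
proof -
  have le: "AE x in M. e2ennreal (f n x) \<le> e2ennreal (g x)" for n
    using bound[of n] by eventually_elim (rule e2ennreal_mono)
  have "AE x in M. (\<lambda>n. e2ennreal (f n x)) \<longlonglongrightarrow> e2ennreal (F x)"
    using lim by eventually_elim (rule tendsto_e2ennrealI)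
  then show conv: "(\<lambda>n. \<integral>\<^sup>+x. e2ennreal (f n x) \<partial>M) \<longlonglongrightarrow> (\<integral>\<^sup>+x. e2ennreal (F x) \<partial>M)"
    by (intro nn_integral_dominated_convergence[OF _ _ _ le finite]) measurable
  have "(\<integral>\<^sup>+x. e2ennreal (F x) \<partial>M) \<le> (\<integral>\<^sup>+x. e2ennreal (g x) \<partial>M)"
    using le by (intro LIMSEQ_le_const2[OF conv]) (auto intro: nn_integral_mono_AE)
  then show "(\<integral>\<^sup>+x. e2ennreal (F x) \<partial>M) < \<infinity>"
    using finite by (rule le_less_trans)
qed

lemma le_abs_ereal:
  fixes a :: ereal
  shows "a \<le> \<bar>a\<bar>" "- a \<le> \<bar>a\<bar>"
  by (cases a; simp)+

lemma enn2ereal_less_infinity_iff: "enn2ereal a < \<infinity> \<longleftrightarrow> a < \<infinity>"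
  by (cases a) auto

theorem theorem4p4p4:
  fixes f :: "nat \<Rightarrow> real \<Rightarrow> ereal" and F g :: "real \<Rightarrow> ereal"
  assumes "\<And>n. f n \<in> borel_measurable unit_lebesgue"
    and "\<And>x. x \<in> {0..1} \<Longrightarrow> 0 \<le> g x"
    and "ext_integrable g"
    and "\<And>n. AE x in unit_lebesgue. \<bar>f n x\<bar> \<le> g x"
    and "AE x in unit_lebesgue. (\<lambda>n. f n x) \<longlonglongrightarrow> F x"
  shows "ext_integrable F \<and> (\<lambda>n. ext_integral (f n)) \<longlonglongrightarrow> ext_integral F"
proof -
  interpret complete_measure unit_lebesgue
    by (rule complete_measure_lebesgue_on) simp
  note f_meas [measurable] = assms(1)
  have F_meas [measurable]: "F \<in> borel_measurable unit_lebesgue"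
    using assms(1,5) by (rule borel_measurable_AE_LIMSEQ)
  have g_meas [measurable]: "g \<in> borel_measurable unit_lebesgue"
    using assms(3) by (simp add: ext_integrable_def)
  have g_fin: "(\<integral>\<^sup>+x. e2ennreal (g x) \<partial>unit_lebesgue) < \<infinity>"
    using assms(3) nonneg_integral_pos_part[OF g_meas]
    by (simp only: ext_integrable_def enn2ereal_less_infinity_iff)
  have bound_pos: "AE x in unit_lebesgue. f n x \<le> g x" for n
    using assms(4)[of n] by eventually_elim (rule order_trans[OF le_abs_ereal(1)])
  have bound_neg: "AE x in unit_lebesgue. - f n x \<le> g x" for n
    using assms(4)[of n] by eventually_elim (rule order_trans[OF le_abs_ereal(2)])
  have lim_neg: "AE x in unit_lebesgue. (\<lambda>n. - f n x) \<longlonglongrightarrow> - F x"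
    using assms(5) by eventually_elim (simp add: ereal_Lim_uminus[symmetric])
  note pos = nn_integral_e2ennreal_dominated[OF f_meas F_meas g_meas bound_pos g_fin assms(5)]
  have neg_f_meas: "(\<lambda>x. - f n x) \<in> borel_measurable unit_lebesgue" for n
    by measurable
  have neg_F_meas: "(\<lambda>x. - F x) \<in> borel_measurable unit_lebesgue"
    by measurable
  note neg = nn_integral_e2ennreal_dominated[OF neg_f_meas neg_F_meas g_meas bound_neg g_fin lim_neg]
  have "ext_integrable F"
    using F_meas pos(2) neg(2)
    by (simp add: ext_integrable_def nonneg_integral_pos_part nonneg_integral_neg_part
        enn2ereal_less_infinity_iff less_top)
  moreover have "(\<lambda>n. ext_integral (f n)) \<longlonglongrightarrow> ext_integral F"
    unfolding ext_integral_def nonneg_integral_pos_part[OF f_meas]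
      nonneg_integral_neg_part[OF f_meas] nonneg_integral_pos_part[OF F_meas]
      nonneg_integral_neg_part[OF F_meas]
    using pos neg
    by (intro tendsto_diff_ereal tendsto_enn2erealI)
      (auto simp flip: enn2ereal_less_infinity_iff)
  ultimately show ?thesis ..
qed

end
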